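(* Let $\Pi$ be a convex polytope with (finite) vertex set $V=\{\mathbf v_1,\dots,\mathbf v_n\}$, and let $I=[0,1]$. Let $K_\Pi$ be the set of all coordinate systems on $\Pi$, each coordinate system $\lambda$ being regarded as the element $(\mathbf a,\mathbf v)\mapsto\langle\mathbf a|\mathbf v\rangle_\lambda$ of the hypercube $I^{\Pi\times V}$. Then $K_\Pi$ is a convex subset of $I^{\Pi\times V}$ under the pointwise barycentric operations; that is, for all $\lambda,\lambda'\in K_\Pi$ and every $p\in{]0,1[}$, the function $$(\mathbf a,\mathbf v)\mapsto (1-p)\,\langle\mathbf a|\mathbf v\rangle_\lambda+p\,\langle\mathbf a|\mathbf v\rangle_{\lambda'}$$ again belongs to $K_\Pi$.
   Context: A convex polytope $\Pi$ is the convex hull of a finite set of points in a real vector space; $V$ is its set of vertices (extreme points). $I^\Pi$ denotes the set of all functions $\Pi\to I=[0,1]$. A coordinate system for $\Pi$ is a map $\lambda\colon V\to I^\Pi$, written $\mathbf v\mapsto|\mathbf v\rangle_\lambda$, with the value of the function $|\mathbf v\rangle_\lambda$ at $\mathbf a\in\Pi$ written $\langle\mathbf a|\mathbf v\rangle_\lambda\in I$, such that the barycentric (linear precision) property holds: every $\mathbf a\in\Pi$ is expressed as the barycentric combination $$\mathbf a=\sum_{\mathbf v\in V}\langle\mathbf a|\mathbf v\rangle_\lambda\,\mathbf v .$$ Here "barycentric combination" means convex combination, so it is part of the meaning of this property that the coefficients $\langle\mathbf a|\mathbf v\rangle_\lambda\in I$ satisfy $\sum_{\mathbf v\in V}\langle\mathbf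 a|\mathbf v\rangle_\lambda=1$ for each $\mathbf a\in\Pi$. A map $V\to I^\Pi$ is identified by currying with an element of $I^{\Pi\times V}$. For $p\in{]0,1[}$ the barycentric operation on $I$ is $xy\,\underline p=(1-p)x+py$, and it is extended pointwise to functions with values in $I$. *)

theory Defs
  imports "HOL-Analysis.Analysis"
begin

definition vertices :: "'a::real_vector set \<Rightarrow> 'a set" where
  "vertices P = {v. v extreme_point_of P}"

text \<open>The vertex set of a polytope is finite, so the sums over \<open>vertices P\<close> below
  are genuine finite sums.\<close>

lemma finite_vertices:
  fixes P :: "'a::real_vector set"
  assumes "polytope P"
  shows "finite (vertices P)"
proof -
  from assms obtain F where F: "finite F" "P = convex hull F"
    by (auto simp: polytope_def)
  have "vertices P \<subseteq> F"
    using F by (auto simp: vertices_def intro: extreme_point_of_convex_hull)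
  then show ?thesis
    using F(1) finite_subset by blast
qed

text \<open>\<open>l v a\<close> is the coordinate of the point \<open>a\<close> at the vertex \<open>v\<close>. The extensional function
  spaces make \<open>l\<close> a map from the vertices to functions \<open>P \<rightarrow> [0,1]\<close> and nothing more.\<close>

definition coordinate_system :: "'a::real_vector set \<Rightarrow> ('a \<Rightarrow> 'a \<Rightarrow> real) \<Rightarrow> bool" where
  "coordinate_system P l \<longleftrightarrow>
     l \<in> vertices P \<rightarrow>\<^sub>E (P \<rightarrow>\<^sub>E {0..1}) \<and>
     (\<forall>a\<in>P. (\<Sum>v\<in>vertices P. l v a) = 1 \<and> a = (\<Sum>v\<in>vertices P. l v a *\<^sub>R v))"

definition hypercube :: "'b set \<Rightarrow> ('b \<Rightarrow> real) set" where
  "hypercube S = S \<rightarrow>\<^sub>E {0..1}"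

text \<open>All coordinate systems on \<open>P\<close>, each regarded as an element of the hypercube over
  \<open>P \<times> vertices P\<close>; note the swap of arguments.\<close>

definition coordinate_systems :: "'a::real_vector set \<Rightarrow> ('a \<times> 'a \<Rightarrow> real) set" where
  "coordinate_systems P =
     {restrict (\<lambda>(a, v). l v a) (P \<times> vertices P) | l. coordinate_system P l}"

text \<open>The barycentric operation on real numbers and its pointwise extension to functions
  with domain \<open>S\<close>.\<close>

definition bary :: "real \<Rightarrow> real \<Rightarrow> real \<Rightarrow> real" where
  "bary p x y = (1 - p) * x + p * y"

definition bary_fun :: "'b set \<Rightarrow> real \<Rightarrow> ('b \<Rightarrow> real) \<Rightarrow> ('b \<Rightarrow> real) \<Rightarrow> 'b \<Rightarrow> real" where
  "bary_fun S p f g = restrict (\<lambda>s. bary p (f s) (g s)) S"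

end

theory Submission
  imports Defs
begin

text \<open>The conditions that single out the coordinate systems inside the hypercube, namely
  \<open>\<Sum>\<^sub>v f (a, v) = 1\<close> and \<open>\<Sum>\<^sub>v f (a, v) v = a\<close> for each \<open>a\<close>, are affine in \<open>f\<close>: the left-hand sides are
  linear and the right-hand sides do not depend on \<open>f\<close>. Since \<open>(1 - p) c + p c = c\<close>, they pass to
  every barycentric combination of two solutions. The coordinate systems thus form the intersection
  of a convex cube with an affine subspace. This description is
  \<open>coordinate_systems_iff\<close>; the theorem follows from it and from the convexity of the cube.\<close>

text \<open>Uncurrying is a bijection between the extensional maps \<open>vertices P \<rightarrow> (P \<rightarrow> [0,1])\<close> and the
  hypercube, so the existential over curried maps can be removed and the barycentric conditions
  imposed on \<open>f\<close> itself.\<close>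

lemma coordinate_systems_iff:
  "f \<in> coordinate_systems P \<longleftrightarrow>
     f \<in> hypercube (P \<times> vertices P) \<and>
     (\<forall>a\<in>P. (\<Sum>v\<in>vertices P. f (a, v)) = 1 \<and> (\<Sum>v\<in>vertices P. f (a, v) *\<^sub>R v) = a)"
  (is "?L \<longleftrightarrow> ?R")
proof
  assume ?L
  then obtain l where l: "coordinate_system P l"
    and f: "f = restrict (\<lambda>(a, v). l v a) (P \<times> vertices P)"
    by (auto simp: coordinate_systems_def)
  have "f \<in> hypercube (P \<times> vertices P)"
  proof -
    have "l \<in> vertices P \<rightarrow>\<^sub>E (P \<rightarrow>\<^sub>E {0..1})"
      using l by (simp only: coordinate_system_def)
    then show ?thesis
      unfolding f hypercube_def by (auto simp: PiE_iff)
  qed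
  moreover have "(\<Sum>v\<in>vertices P. f (a, v)) = (\<Sum>v\<in>vertices P. l v a)"
    and "(\<Sum>v\<in>vertices P. f (a, v) *\<^sub>R v) = (\<Sum>v\<in>vertices P. l v a *\<^sub>R v)" if "a \<in> P" for a
    using that by (auto simp: f intro!: sum.cong)
  ultimately show ?R
    using l unfolding coordinate_system_def by metis
next
  assume R: ?R
  define l where "l = (\<lambda>v\<in>vertices P. \<lambda>a\<in>P. f (a, v))"
  have "l \<in> vertices P \<rightarrow>\<^sub>E (P \<rightarrow>\<^sub>E {0..1})"
    using R by (auto simp: l_def hypercube_def PiE_iff)
  moreover have "(\<Sum>v\<in>vertices P. l v a) = (\<Sum>v\<in>vertices P. f (a, v))"
    and "(\<Sum>v\<in>vertices P. l v a *\<^sub>R v) = (\<Sum>v\<in>vertices P. f (a, v) *\<^sub>R v)" if "a \<in> P" for a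
    using that by (auto simp: l_def intro!: sum.cong)
  ultimately have "coordinate_system P l"
    using R unfolding coordinate_system_def by metis
  moreover have "f = restrict (\<lambda>(a, v). l v a) (P \<times> vertices P)"
    using R by (auto simp: l_def hypercube_def PiE_iff extensional_def fun_eq_iff restrict_def)
  ultimately show ?L
    by (auto simp: coordinate_systems_def)
qed

lemma bary_fun_in_hypercube:
  assumes "f \<in> hypercube S" "g \<in> hypercube S" "p \<in> {0..1}"
  shows "bary_fun S p f g \<in> hypercube S"
proof -
  have "bary p (f s) (g s) \<in> {0..1}" if "s \<in> S" for s
  proof -
    have fg: "f s \<in> {0..1}" "g s \<in> {0..1}"
      using assms that by (auto simp: hypercube_def)
    then show ?thesis
      using assms(3) convex_bound_le[of "f s" 1 "g s" "1 - p" p]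
      by (simp add: bary_def)
  qed
  then show ?thesis
    by (simp add: bary_fun_def hypercube_def)
qed

theorem theorem3p5:
  fixes P :: "'a::real_vector set"
  assumes "polytope P"
  shows "coordinate_systems P \<subseteq> hypercube (P \<times> vertices P) \<and>
    (\<forall>f\<in>coordinate_systems P. \<forall>g\<in>coordinate_systems P. \<forall>p\<in>{0<..<1}.
       bary_fun (P \<times> vertices P) p f g \<in> coordinate_systems P)"
proof (intro conjI ballI)
  show "coordinate_systems P \<subseteq> hypercube (P \<times> vertices P)"
    by (auto simp: coordinate_systems_iff)
next
  fix f g and p :: real
  assume f: "f \<in> coordinate_systems P" and g: "g \<in> coordinate_systems P"
    and p: "p \<in> {0<..<1}"
  let ?V = "vertices P" and ?h = "bary_fun (P \<times> vertices P) p f g"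
  have "?h \<in> hypercube (P \<times> ?V)"
    using f g p by (auto simp: coordinate_systems_iff intro!: bary_fun_in_hypercube)
  moreover have "(\<Sum>v\<in>?V. ?h (a, v)) = 1 \<and> (\<Sum>v\<in>?V. ?h (a, v) *\<^sub>R v) = a" if a: "a \<in> P" for a
  proof
    have h: "?h (a, v) = (1 - p) * f (a, v) + p * g (a, v)" if "v \<in> ?V" for v
      using a that by (simp add: bary_fun_def bary_def)
    have "(\<Sum>v\<in>?V. ?h (a, v)) = (1 - p) * (\<Sum>v\<in>?V. f (a, v)) + p * (\<Sum>v\<in>?V. g (a, v))"
      by (simp add: h sum.distrib sum_distrib_left)
    also have "\<dots> = 1"
      using f g a by (simp add: coordinate_systems_iff)
    finally show "(\<Sum>v\<in>?V. ?h (a, v)) = 1" .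
    have "(\<Sum>v\<in>?V. ?h (a, v) *\<^sub>R v) =
        (1 - p) *\<^sub>R (\<Sum>v\<in>?V. f (a, v) *\<^sub>R v) + p *\<^sub>R (\<Sum>v\<in>?V. g (a, v) *\<^sub>R v)"
      by (simp add: h scaleR_add_left sum.distrib scaleR_sum_right)
    also have "\<dots> = (1 - p) *\<^sub>R a + p *\<^sub>R a"
      using f g a by (simp add: coordinate_systems_iff)
    also have "\<dots> = a"
      by (simp flip: scaleR_add_left)
    finally show "(\<Sum>v\<in>?V. ?h (a, v) *\<^sub>R v) = a" .
  qed
  ultimately show "?h \<in> coordinate_systems P"
    by (simp add: coordinate_systems_iff)
qed

end
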